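(* Let $x$ be any finite word over $\Sigma_3=\{0,1,2\}$ with $|x|\geq 4$. Then there exists an infinite squarefree word over $\Sigma_3$ that contains no occurrence of $x$.
   Context: $|x|$ denotes the length of the word $x$. An infinite word over an alphabet $\Sigma$ is a right-infinite sequence $w=w_1w_2w_3\cdots$ of letters of $\Sigma$. A word $u$ occurs in $w$ (is a subword of $w$) if $u$ appears as a block of consecutive letters of $w$. A square is a word of the form $yy$ with $y$ a nonempty word; a word is squarefree if none of its subwords is a square. *)

theory Defs
  imports Main "HOL-Library.Omega_Words_Fun"
begin

text \<open>
  Finite words are lists and right-infinite words are functions on \<^typ>\<open>nat\<close>
  (so positions start at 0); \<open>w [i \<rightarrow> j]\<close> is the finite block of letters of \<open>w\<close>
  at the positions \<open>i, \<dots>, j - 1\<close>.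
\<close>

definition Sigma3 :: "nat set" where
  "Sigma3 = {0, 1, 2}"

definition occurs_in :: "'a list \<Rightarrow> 'a word \<Rightarrow> bool" where
  "occurs_in u w \<longleftrightarrow> (\<exists>i. w [i \<rightarrow> i + length u] = u)"

definition is_square :: "'a list \<Rightarrow> bool" where
  "is_square u \<longleftrightarrow> (\<exists>y. y \<noteq> [] \<and> u = y @ y)"

definition squarefree_word :: "'a word \<Rightarrow> bool" where
  "squarefree_word w \<longleftrightarrow> \<not> (\<exists>u. occurs_in u w \<and> is_square u)"

end

theory Submission
  imports Defs
begin

text \<open>
  The differences \<open>t (n + 1) - t n\<close> of the Thue-Morse sequence \<open>t\<close> form a ternary word which
  is squarefree because \<open>t\<close> is overlap-free. Coding the differences \<open>-1, 0, 1\<close> by \<open>p, q, r\<close>,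
  this word contains neither \<open>pqp\<close> (partial sums of \<open>t\<close> would leave \<open>{0, 1}\<close>) nor \<open>qprq\<close>
  (\<open>t\<close> does not contain \<open>11011\<close>). Up to renaming letters, a squarefree word of length four
  is \<open>abac\<close>, \<open>abcb\<close> or \<open>abca\<close>, so it is avoided for a suitable choice of \<open>p, q, r\<close>.
\<close>

fun thue_morse :: "nat \<Rightarrow> bool" where
  "thue_morse 0 = False"
| "thue_morse (Suc n) = (thue_morse (Suc n div 2) \<noteq> odd (Suc n))"

declare thue_morse.simps(2) [simp del]

lemma thue_morse_double [simp]: "thue_morse (2 * n) = thue_morse n"
proof (cases n)
  case (Suc m)
  then show ?thesis using thue_morse.simps(2)[of "Suc (2 * m)"] by simp
qed simp

lemma thue_morse_Suc_double [simp]: "thue_morse (Suc (2 * n)) = (\<not> thue_morse n)"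
  using thue_morse.simps(2)[of "2 * n"] by simp

text \<open>Positions \<open>2 * m\<close> and \<open>2 * m + 1\<close> carry the image of one
  letter under 0 -> 01, 1 -> 10. This parity obstruction settles both odd periods and the word
  \<open>qprq\<close>.\<close>

lemma thue_morse_Suc_even: "even n \<Longrightarrow> thue_morse (Suc n) \<noteq> thue_morse n"
  by (auto elim!: evenE)

text \<open>Descent on the period: an overlap of even period yields one of half the period, and an
  odd period contradicts the alternation it forces.\<close>

lemma thue_morse_overlap_free:
  assumes "p > 0"
  shows "\<exists>j\<le>p. thue_morse (i + j) \<noteq> thue_morse (i + j + p)"
  using assms
proof (induction p arbitrary: i rule: less_induct)
  case (less p)
  show ?case
  proof (rule ccontr)
    assume "\<not> ?thesis"
    then have per: "thue_morse (i + j) = thue_morse (i + j + p)" if "j \<le> p" for j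
      using that by blast
    show False
    proof (cases "even p")
      case True
      then obtain q where q: "p = 2 * q" by blast
      define k where "k = i div 2"
      \<comment> \<open>Only positions of the parity of \<open>i\<close> are read; there the
        sequence copies itself from \<open>k\<close> on, complemented if \<open>i\<close> is odd,
        which preserves equalities.\<close>
      have "thue_morse (k + m) = thue_morse (k + m + q)" if "m \<le> q" for m
      proof (cases "even i")
        case True
        then have eqs: "i + 2 * m = 2 * (k + m)" "i + 2 * m + p = 2 * (k + m + q)"
          by (auto simp: k_def q)
        have "2 * m \<le> p" using that q by simp
        from per[OF this] show ?thesis
          unfolding eqs(2) unfolding eqs(1) by (simp only: thue_morse_double)
      next
        case False
        then have eqs: "i + 2 * m = Suc (2 * (k + m))" "i + 2 * m + p = Suc (2 * (k + m + q))"
          by (auto simp: k_def q elim!: oddE)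
        have "2 * m \<le> p" using that q by simp
        from per[OF this] show ?thesis
          unfolding eqs(2) unfolding eqs(1) by (simp only: thue_morse_Suc_double simp_thms)
      qed
      moreover have "q < p" "q > 0" using q less.prems by auto
      ultimately show False using less.IH by blast
    next
      case False
      \<comment> \<open>For odd \<open>p\<close> one of \<open>i + j\<close>, \<open>i + j + p\<close> is even, so the sequence alternates
          on \<open>{i..i + p}\<close>.\<close>
      have step: "thue_morse (i + Suc j) \<noteq> thue_morse (i + j)" if "j < p" for j
      proof (cases "even (i + j)")
        case True
        then show ?thesis using thue_morse_Suc_even by simp
      next
        case odd: False
        with False have "thue_morse (Suc (i + j + p)) \<noteq> thue_morse (i + j + p)"
          by (intro thue_morse_Suc_even) simp
        with per[of j] per[of "Suc j"] that show ?thesis by simp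
      qed
      have "thue_morse (i + j) = (thue_morse i \<noteq> odd j)" if "j \<le> p" for j
        using that
      proof (induction j)
        case (Suc j)
        then show ?case using step[of j] by simp
      qed simp
      from this[of p] per[of 0] False show False by simp
    qed
  qed
qed

definition tm_diff :: "'a \<Rightarrow> 'a \<Rightarrow> 'a \<Rightarrow> 'a word" where
  "tm_diff p q r n =
    (if thue_morse (Suc n) = thue_morse n then q else if thue_morse n then p else r)"

lemma range_tm_diff: "range (tm_diff p q r) \<subseteq> {p, q, r}"
  by (auto simp: tm_diff_def)

lemma occurs_in_iff_nth: "occurs_in u w \<longleftrightarrow> (\<exists>i. \<forall>j<length u. w (i + j) = u ! j)"
  unfolding occurs_in_def list_eq_iff_nth_eq[of "w [_ \<rightarrow> _]"] by simp

lemma occurs_in_append_left: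
  assumes "occurs_in (u @ v) w"
  shows "occurs_in u w"
proof -
  obtain i where i: "w (i + j) = (u @ v) ! j" if "j < length (u @ v)" for j
    using assms unfolding occurs_in_iff_nth by blast
  have "w (i + j) = u ! j" if "j < length u" for j
    using i[of j] that by (simp add: nth_append)
  then show ?thesis unfolding occurs_in_iff_nth by blast
qed

lemma tm_diff_no_square:
  assumes "distinct [p, q, r]" and "k > 0"
  shows "\<exists>j<k. tm_diff p q r (i + j) \<noteq> tm_diff p q r (i + j + k)"
proof (rule ccontr)
  assume "\<not> ?thesis"
  then have eq: "tm_diff p q r (i + j) = tm_diff p q r (i + j + k)" if "j < k" for j
    using that by blast
  show False
  proof (cases "thue_morse i = thue_morse (i + k)")
    case True
    \<comment> \<open>Equal starting values and equal differences propagate to \<open>k + 1\<close>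
      positions, which is an overlap.\<close>
    have "thue_morse (i + j) = thue_morse (i + j + k)" if "j \<le> k" for j
      using that
    proof (induction j)
      case (Suc j)
      then show ?case using eq[of j] assms(1) by (auto simp: tm_diff_def split: if_splits)
    qed (use True in simp)
    with thue_morse_overlap_free[OF \<open>k > 0\<close>] show False by blast
  next
    case False
    \<comment> \<open>A common nonzero difference would force equal values, so all differences
      vanish and the sequence is constant from \<open>i\<close> to \<open>i + k\<close>.\<close>
    have "thue_morse (i + j) = thue_morse i \<and> thue_morse (i + j + k) = thue_morse (i + k)"
      if "j \<le> k" for j
      using that
    proof (induction j)
      case (Suc j)
      then show ?case using eq[of j] assms(1) False
        by (auto simp: tm_diff_def split: if_splits)
    qed simp
    from this[of k] False show False by simp
  qed
qed

lemma squarefree_tm_diff: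
  assumes "distinct [p, q, r]"
  shows "squarefree_word (tm_diff p q r)"
  unfolding squarefree_word_def is_square_def
proof clarify
  fix y :: "'a list"
  assume occ: "occurs_in (y @ y) (tm_diff p q r)" and "y \<noteq> []"
  then obtain i where i: "\<And>j. j < length (y @ y) \<Longrightarrow> tm_diff p q r (i + j) = (y @ y) ! j"
    unfolding occurs_in_iff_nth by blast
  have "tm_diff p q r (i + j) = tm_diff p q r (i + j + length y)" if "j < length y" for j
    using i[of j] i[of "j + length y"] that by (simp add: nth_append add.assoc)
  with tm_diff_no_square[OF assms, of "length y" i] \<open>y \<noteq> []\<close> show False by auto
qed

lemma tm_diff_avoids_pqp:
  assumes "distinct [p, q, r]"
  shows "\<not> (tm_diff p q r n = p \<and> tm_diff p q r (Suc n) = q \<and> tm_diff p q r (Suc (Suc n)) = p)"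
  using assms by (auto simp: tm_diff_def split: if_splits)

text \<open>The two letters \<open>q\<close> are three apart, so one of them sits at an even
  position, where the Thue-Morse sequence changes value.\<close>

lemma tm_diff_avoids_qprq:
  assumes "distinct [p, q, r]"
  shows "\<not> (tm_diff p q r n = q \<and> tm_diff p q r (Suc n) = p \<and>
    tm_diff p q r (Suc (Suc n)) = r \<and> tm_diff p q r (Suc (Suc (Suc n))) = q)"
  using assms thue_morse_Suc_even[of n] thue_morse_Suc_even[of "Suc (Suc (Suc n))"]
  by (auto simp: tm_diff_def split: if_splits)

lemma tm_diff_no_repeated_letter:
  assumes "distinct [p, q, r]"
  shows "tm_diff p q r (Suc n) \<noteq> tm_diff p q r n"
  using tm_diff_no_square[OF assms, of 1 n] by simp

lemma exists_tm_diff_avoiding: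
  assumes "{a, b, c, d} \<subseteq> Sigma3"
  shows "\<exists>p q r. distinct [p, q, r] \<and> {p, q, r} \<subseteq> Sigma3 \<and> \<not> occurs_in [a, b, c, d] (tm_diff p q r)"
proof -
  have occ: "\<exists>n. tm_diff p q r n = a \<and> tm_diff p q r (Suc n) = b \<and>
      tm_diff p q r (Suc (Suc n)) = c \<and> tm_diff p q r (Suc (Suc (Suc n))) = d"
    if "occurs_in [a, b, c, d] (tm_diff p q r)" for p q r :: nat
    using that by (auto simp: occurs_in_iff_nth All_less_Suc eval_nat_numeral)
  \<comment> \<open>The letters of \<open>Sigma3\<close> sum to 3, which gives the witness.\<close>
  have third: "\<exists>r. distinct [p, q, r] \<and> {p, q, r} \<subseteq> Sigma3"
    if "p \<noteq> q" "p \<in> Sigma3" "q \<in> Sigma3" for p q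
    using that by (intro exI[of _ "3 - p - q"]) (auto simp: Sigma3_def)
  \<comment> \<open>Outside the first three cases \<open>a\<close>, \<open>b\<close>,
    \<open>c\<close> are distinct and \<open>d\<close> differs from \<open>b\<close> and
    \<open>c\<close>, so \<open>d = a\<close>.\<close>
  consider "a = b \<or> b = c \<or> c = d" | "a \<noteq> b" "a = c" | "b \<noteq> c" "b = d"
    | "distinct [b, a, c]" "d = a"
    using assms by (auto simp: Sigma3_def)
  then show ?thesis
  proof cases
    case 1
    have letters: "distinct [0, 1, 2::nat]" "{0, 1, 2} \<subseteq> Sigma3" by (auto simp: Sigma3_def)
    have "\<not> occurs_in [a, b, c, d] (tm_diff 0 1 2)"
      using occ[of 0 1 2] tm_diff_no_repeated_letter[OF letters(1)] 1 by metis
    with letters show ?thesis by blast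
  next
    case 2
    with assms third[of a b] obtain r
      where r: "distinct [a, b, r]" "{a, b, r} \<subseteq> Sigma3" by auto
    have "\<not> occurs_in [a, b, c, d] (tm_diff a b r)"
      using occ[of a b r] tm_diff_avoids_pqp[OF r(1)] 2(2) by metis
    with r show ?thesis by blast
  next
    case 3
    with assms third[of b c] obtain r
      where r: "distinct [b, c, r]" "{b, c, r} \<subseteq> Sigma3" by auto
    \<comment> \<open>Here \<open>pqp\<close> is the block \<open>bcd\<close>, starting at the
      second letter.\<close>
    have "\<not> occurs_in [a, b, c, d] (tm_diff b c r)"
      using occ[of b c r] tm_diff_avoids_pqp[OF r(1)] 3(2) by metis
    with r show ?thesis by blast
  next
    case 4
    with assms have "{b, a, c} \<subseteq> Sigma3" by simp
    \<comment> \<open>The word \<open>abca\<close> reads as \<open>qprq\<close> when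
      \<open>a\<close> codes difference 0.\<close>
    moreover have "\<not> occurs_in [a, b, c, d] (tm_diff b a c)"
      using occ[of b a c] tm_diff_avoids_qprq[OF 4(1)] 4(2) by metis
    ultimately show ?thesis using 4(1) by blast
  qed
qed

theorem theorem3:
  fixes x :: "nat list"
  assumes "set x \<subseteq> Sigma3"
    and "length x \<ge> 4"
  shows "\<exists>w :: nat word. range w \<subseteq> Sigma3 \<and> squarefree_word w \<and> \<not> occurs_in x w"
proof -
  \<comment> \<open>Avoiding the prefix of length four suffices to avoid \<open>x\<close>.\<close>
  obtain a b c d y where x: "x = [a, b, c, d] @ y"
    using assms(2) by (auto simp: eval_nat_numeral Suc_le_length_iff)
  with assms(1) obtain p q r where pqr: "distinct [p, q, r]" "{p, q, r} \<subseteq> Sigma3"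
    and avoid: "\<not> occurs_in [a, b, c, d] (tm_diff p q r)"
    using exists_tm_diff_avoiding[of a b c d] by auto
  show ?thesis
    using range_tm_diff[of p q r] pqr squarefree_tm_diff[OF pqr(1)] avoid occurs_in_append_left
    unfolding x by (intro exI[of _ "tm_diff p q r"]) blast
qed

end
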